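(* Let $n\ge 1$ and let $\psi:\mathbb{R}^n\to\mathbb{R}$ be a real-valued continuous negative definite function. Then for any pair of i.i.d. random vectors $X,Y$ in $\mathbb{R}^n$ one has $$\mathbb{E}\,\psi(X-Y)\le \mathbb{E}\,\psi(X+Y).$$
   Context: A real-valued continuous negative definite function $\psi:\mathbb{R}^n\to\mathbb{R}$ is a function admitting the Lévy–Khintchine representation $$\psi(\xi)=a+\tfrac12\langle Q\xi,\xi\rangle+\int_{\mathbb{R}^n\setminus\{0\}}\bigl(1-\cos\langle\xi,u\rangle\bigr)\,\nu(du),\qquad \xi\in\mathbb{R}^n,$$ where $a\ge 0$ is a constant, $Q\in\mathbb{R}^{n\times n}$ is a symmetric positive semidefinite matrix and $\nu$ is a measure on $\mathbb{R}^n\setminus\{0\}$ with $\int_{\mathbb{R}^n\setminus\{0\}}\min\{\|u\|_2^2,1\}\,\nu(du)<\infty$. Here $\|\cdot\|_2$ is the Euclidean norm and $\langle\cdot,\cdot\rangle$ the Euclidean inner product. Such a $\psi$ is nonnegative, so the expectations are well defined in $[0,\infty]$ and the inequality is understood in $[0,\infty]$. *)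

theory Defs
  imports "HOL-Probability.Probability"
begin

definition positive_semidefinite :: "real ^ 'n ^ 'n \<Rightarrow> bool" where
  "positive_semidefinite Q \<longleftrightarrow> transpose Q = Q \<and> (\<forall>x. 0 \<le> (Q *v x) \<bullet> x)"

text \<open>A L\'evy measure is a Borel measure whose underlying space is the punctured space
  \<open>- {0}\<close>, so integrals against it range over nonzero vectors only. It need not be finite near
  the origin.\<close>

definition levy_measure :: "(real ^ 'n) measure \<Rightarrow> bool" where
  "levy_measure \<nu> \<longleftrightarrow>
     sets \<nu> = sets (restrict_space borel (- {0})) \<and>
     (\<integral>\<^sup>+ u. ennreal (min ((norm u)\<^sup>2) 1) \<partial>\<nu>) < \<infinity>"

definition continuous_negative_definite :: "(real ^ 'n \<Rightarrow> real) \<Rightarrow> bool" where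
  "continuous_negative_definite \<psi> \<longleftrightarrow>
     (\<exists>(a::real) Q \<nu>. 0 \<le> a \<and> positive_semidefinite Q \<and> levy_measure \<nu> \<and>
        (\<forall>\<xi>. \<psi> \<xi> = a + 1 / 2 * ((Q *v \<xi>) \<bullet> \<xi>) + (\<integral>u. 1 - cos (\<xi> \<bullet> u) \<partial>\<nu>)))"

text \<open>The integrand of the representation is integrable, so the Bochner integral above
  never takes its default value 0.\<close>

lemma levy_measure_integrable:
  assumes "levy_measure \<nu>"
  shows "integrable \<nu> (\<lambda>u. 1 - cos (\<xi> \<bullet> u))"
proof -
  have S: "sets \<nu> = sets (restrict_space borel (- {0}))"
    and F: "(\<integral>\<^sup>+ u. ennreal (min ((norm u)\<^sup>2) 1) \<partial>\<nu>) < \<infinity>"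
    using assms by (auto simp: levy_measure_def)
  have meas: "f \<in> borel_measurable \<nu>" if "f \<in> borel_measurable borel"
    for f :: "real ^ 'a \<Rightarrow> real"
    using measurable_restrict_space1[OF that] by (simp add: measurable_cong_sets[OF S refl])
  define C where "C = max 2 ((norm \<xi>)\<^sup>2)"
  have "integrable \<nu> (\<lambda>u. min ((norm u)\<^sup>2) 1)"
    using F by (intro integrableI_bounded meas) auto
  then have I: "integrable \<nu> (\<lambda>u. C * min ((norm u)\<^sup>2) 1)"
    by simp
  have bound: "1 - cos (\<xi> \<bullet> u) \<le> C * min ((norm u)\<^sup>2) 1" for u
  proof (cases "(norm u)\<^sup>2 \<le> 1")
    case True
    have "1 - cos (\<xi> \<bullet> u) = 2 * (sin ((\<xi> \<bullet> u) / 2))\<^sup>2"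
      using cos_double_sin[of "(\<xi> \<bullet> u) / 2"] by simp
    also have "\<dots> \<le> 2 * ((\<xi> \<bullet> u) / 2)\<^sup>2"
      using abs_sin_x_le_abs_x[of "(\<xi> \<bullet> u) / 2"] by (simp only: abs_le_square_iff)
    also have "\<dots> \<le> (\<xi> \<bullet> u)\<^sup>2"
      by (simp add: power_divide)
    also have "\<dots> \<le> (norm \<xi> * norm u)\<^sup>2"
      using Cauchy_Schwarz_ineq2[of \<xi> u] by (simp add: abs_le_square_iff[symmetric])
    also have "\<dots> \<le> C * (norm u)\<^sup>2"
      unfolding C_def power_mult_distrib by (intro mult_right_mono) auto
    finally show ?thesis using True by simp
  next
    case False
    have "1 - cos (\<xi> \<bullet> u) \<le> C"
      unfolding C_def using cos_ge_minus_one[of "\<xi> \<bullet> u"] by linarith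
    then show ?thesis using False by simp
  qed
  show ?thesis
    by (rule Bochner_Integration.integrable_bound[OF I])
      (auto intro!: meas AE_I2 order.trans[OF bound])
qed

text \<open>Nonnegativity ensures that \<^term>\<open>ennreal (\<psi> \<xi>)\<close> does not truncate.\<close>

lemma continuous_negative_definite_nonneg:
  assumes "continuous_negative_definite \<psi>"
  shows "0 \<le> \<psi> \<xi>"
  using assms
  by (force simp: continuous_negative_definite_def positive_semidefinite_def
      intro!: add_nonneg_nonneg integral_nonneg)

end

theory Submission imports Defs begin

text \<open>
  Write \<open>P\<close> for the common law of \<open>X\<close> and \<open>Y\<close>. By independence both sides are integrals over
  \<open>P \<Otimes>\<^sub>M P\<close>, and the representation of \<open>\<psi>\<close> splits them into a constant, a Gaussian part and a jump
  part, so it suffices to compare the parts one at a time. In each of them the gain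
  \<open>f (x + y) - f (x - y)\<close> is a positive multiple of a kernel \<open>A (\<phi> x) \<bullet> \<phi> y\<close> with \<open>A\<close> linear and
  positive: for \<open>f \<xi> = 1 - cos (\<xi> \<bullet> u)\<close> it is \<open>2 * sin (x \<bullet> u) * sin (y \<bullet> u)\<close>, and for
  \<open>f \<xi> = Q *v \<xi> \<bullet> \<xi>\<close> it is \<open>4 * (Q *v x \<bullet> y)\<close>. If \<open>\<phi>\<close> is bounded, integrating the kernel over the
  product measure gives \<open>A m \<bullet> m \<ge> 0\<close> with \<open>m\<close> the mean of \<open>\<phi>\<close>
  (\<open>integral_positive_kernel_nonneg\<close>).

  The sine is bounded, so for the jump part the comparison holds for each frequency \<open>u\<close>, and Tonelli's
  theorem carries it over to the integral against the L\'evy measure, which is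
  \<open>\<sigma>\<close>-finite. For the Gaussian part \<open>X\<close> need not have any moments; there the comparison is made for
  \<open>\<parallel>x\<parallel>, \<parallel>y\<parallel> \<le> k\<close>, where \<open>\<phi>\<close> is the truncated identity, and monotone convergence
  removes the truncation.
\<close>

section \<open>Positive kernels on a product measure\<close>

text \<open>The double integral factors through the mean \<open>m\<close> of \<open>\<phi>\<close>, by linearity first in \<open>\<phi> y\<close> and then
  in \<open>\<phi> x\<close>, and becomes \<open>A m \<bullet> m\<close>.\<close>

lemma integral_positive_kernel_nonneg:
  fixes \<phi> :: "'a \<Rightarrow> 'b :: euclidean_space"
  assumes P: "prob_space P"
    and meas [measurable]: "\<phi> \<in> borel_measurable P"
    and bounded: "\<And>x. norm (\<phi> x) \<le> C"
    and linear: "bounded_linear A"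
    and pos: "\<And>v. 0 \<le> A v \<bullet> v"
  shows "integrable (P \<Otimes>\<^sub>M P) (\<lambda>z. A (\<phi> (fst z)) \<bullet> \<phi> (snd z))" (is "integrable _ ?K")
    and "0 \<le> (\<integral>z. A (\<phi> (fst z)) \<bullet> \<phi> (snd z) \<partial>(P \<Otimes>\<^sub>M P))"
proof -
  interpret prob_space P by fact
  interpret PP: pair_prob_space P P ..
  obtain B where B: "\<And>v. norm (A v) \<le> norm v * B" and "B \<ge> 0"
    using bounded_linear.nonneg_bounded[OF linear] by blast
  have [measurable]: "A \<in> borel_measurable borel"
    using linear by (intro borel_measurable_continuous_onI linear_continuous_on)
  have "\<bar>?K z\<bar> \<le> (C * B) * C" for z
  proof -
    have "\<bar>?K z\<bar> \<le> norm (A (\<phi> (fst z))) * norm (\<phi> (snd z))"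
      by (rule Cauchy_Schwarz_ineq2)
    also have "\<dots> \<le> (C * B) * C"
      using B[of "\<phi> (fst z)"] bounded[of "fst z"] bounded[of "snd z"] \<open>B \<ge> 0\<close>
      by (intro mult_mono order.trans[OF B] mult_right_mono)
        (auto intro!: mult_nonneg_nonneg intro: order.trans[OF norm_ge_zero])
    finally show ?thesis .
  qed
  then show int: "integrable (P \<Otimes>\<^sub>M P) ?K"
    by (intro PP.P.integrable_const_bound[of _ "(C * B) * C"]) auto
  have int_\<phi>: "integrable P \<phi>"
    using bounded by (intro integrable_const_bound[of _ C]) auto
  define m where "m = (\<integral>x. \<phi> x \<partial>P)"
  have "(\<integral>z. ?K z \<partial>(P \<Otimes>\<^sub>M P)) = (\<integral>x. (\<integral>y. A (\<phi> x) \<bullet> \<phi> y \<partial>P) \<partial>P)"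
    using PP.integral_fst'[OF int] by simp
  also have "\<dots> = (\<integral>x. A (\<phi> x) \<bullet> m \<partial>P)"
    using int_\<phi> by (simp add: m_def)
  also have "\<dots> = A m \<bullet> m"
    using int_\<phi>
    by (simp add: m_def integral_bounded_linear[OF linear] integrable_bounded_linear[OF linear])
  finally show "0 \<le> (\<integral>z. ?K z \<partial>(P \<Otimes>\<^sub>M P))"
    using pos by simp
qed

text \<open>This form allows infinite integrals: if \<open>h\<close> has a finite integral, then so has \<open>g\<close> because the
  gain \<open>K\<close> is integrable; otherwise there is nothing to show.\<close>

lemma nn_integral_le_of_integrable_gain:
  fixes g h K :: "'a \<Rightarrow> real"
  assumes [measurable]: "h \<in> borel_measurable N"
    and g: "\<And>z. 0 \<le> g z" and h: "\<And>z. 0 \<le> h z"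
    and gain: "\<And>z. h z = g z + K z"
    and K: "integrable N K" "0 \<le> (\<integral>z. K z \<partial>N)"
  shows "(\<integral>\<^sup>+ z. ennreal (g z) \<partial>N) \<le> (\<integral>\<^sup>+ z. ennreal (h z) \<partial>N)"
proof (cases "(\<integral>\<^sup>+ z. ennreal (h z) \<partial>N) = \<infinity>")
  case False
  then have int_h: "integrable N h"
    using h by (intro integrableI_nonneg) (auto simp: less_top)
  have g_eq: "g = (\<lambda>z. h z - K z)"
    using gain by (auto simp: fun_eq_iff)
  have int_g: "integrable N g"
    unfolding g_eq using int_h K(1) by (rule Bochner_Integration.integrable_diff)
  have "(\<integral>z. g z \<partial>N) \<le> (\<integral>z. h z \<partial>N)"
    unfolding g_eq using int_h K by simp
  then show ?thesis
    using int_g int_h g h by (simp add: nn_integral_eq_integral ennreal_leI)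
qed simp

section \<open>The jump part\<close>

lemma nn_integral_one_minus_cos_diff_le_sum:
  fixes P :: "(real ^ 'n) measure"
  assumes P: "prob_space P" and [measurable_cong]: "sets P = sets borel"
  shows "(\<integral>\<^sup>+ z. ennreal (1 - cos ((fst z - snd z) \<bullet> u)) \<partial>(P \<Otimes>\<^sub>M P))
    \<le> (\<integral>\<^sup>+ z. ennreal (1 - cos ((fst z + snd z) \<bullet> u)) \<partial>(P \<Otimes>\<^sub>M P))"
proof -
  have meas: "(\<lambda>x. sin (x \<bullet> u)) \<in> borel_measurable P"
    by measurable
  note kernel = integral_positive_kernel_nonneg[OF P meas, of 1 "\<lambda>t. t"]
  show ?thesis
  proof (rule nn_integral_le_of_integrable_gain)
    show "1 - cos ((fst z + snd z) \<bullet> u)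
        = (1 - cos ((fst z - snd z) \<bullet> u)) + 2 * (sin (fst z \<bullet> u) \<bullet> sin (snd z \<bullet> u))" for z
      by (simp add: inner_add_left inner_diff_left cos_add cos_diff)
    show "integrable (P \<Otimes>\<^sub>M P) (\<lambda>z. 2 * (sin (fst z \<bullet> u) \<bullet> sin (snd z \<bullet> u)))"
      using kernel(1) by (intro integrable_mult_right) (simp add: bounded_linear_ident)
    show "0 \<le> (\<integral>z. 2 * (sin (fst z \<bullet> u) \<bullet> sin (snd z \<bullet> u)) \<partial>(P \<Otimes>\<^sub>M P))"
      using kernel(2) by (simp add: bounded_linear_ident)
  qed (simp_all, measurable)
qed

lemma levy_measure_measurable_ident:
  fixes \<nu> :: "(real ^ 'n) measure"
  assumes "levy_measure \<nu>"
  shows "(\<lambda>u. u) \<in> measurable \<nu> borel"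
proof -
  have "sets \<nu> = sets (restrict_space borel (- {0}))"
    using assms by (simp add: levy_measure_def)
  then show ?thesis
    by (subst measurable_cong_sets[OF _ refl]) (auto intro: measurable_restrict_space1)
qed

text \<open>The integrable function \<open>min (\<parallel>u\<parallel>\<^sup>2) 1\<close> is strictly positive away from the origin, so the sets
  where it is at least \<open>1 / (k + 1)\<close> exhaust the punctured space and have finite measure by Markov's
  inequality.\<close>

lemma levy_measure_sigma_finite:
  fixes \<nu> :: "(real ^ 'n) measure"
  assumes "levy_measure \<nu>"
  shows "sigma_finite_measure \<nu>"
proof
  have S: "sets \<nu> = sets (restrict_space borel (- {0}))"
    and F: "(\<integral>\<^sup>+ u. ennreal (min ((norm u)\<^sup>2) 1) \<partial>\<nu>) < \<infinity>"
    using assms by (auto simp: levy_measure_def)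
  have space: "space \<nu> = - {0}"
    using sets_eq_imp_space_eq[OF S] by (simp add: space_restrict_space)
  define w :: "real ^ 'n \<Rightarrow> real" where "w = (\<lambda>u. min ((norm u)\<^sup>2) 1)"
  have "w \<in> borel_measurable (restrict_space borel (- {0}))"
    unfolding w_def by (intro measurable_restrict_space1) simp
  then have [measurable]: "w \<in> borel_measurable \<nu>"
    by (simp add: measurable_cong_sets[OF S refl])
  have w_nonneg: "0 \<le> w u" for u
    by (simp add: w_def)
  define A where "A k = {u \<in> space \<nu>. 1 / real (Suc k) \<le> w u}" for k
  have A_sets: "A k \<in> sets \<nu>" for k
    unfolding A_def by measurable
  have "emeasure \<nu> (A k) \<noteq> \<infinity>" for k
  proof -
    have A_eq: "A k = {u \<in> space \<nu>. 1 \<le> ennreal (real (Suc k)) * ennreal (w u)}"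
      unfolding A_def
      by (intro Collect_cong conj_cong refl)
        (simp add: w_nonneg ennreal_mult[symmetric] field_simps del: of_nat_Suc
          flip: ennreal_1)
    have "emeasure \<nu> (A k) \<le> ennreal (real (Suc k)) * (\<integral>\<^sup>+ u. ennreal (w u) \<partial>\<nu>)"
      using nn_integral_Markov_inequality[of "\<lambda>u. ennreal (w u)" "space \<nu>" \<nu>
          "ennreal (real (Suc k))"]
      by (simp add: A_eq del: of_nat_Suc cong: nn_integral_cong_simp)
    also have "\<dots> < \<infinity>"
      using F by (simp add: w_def ennreal_mult_less_top del: of_nat_Suc)
    finally show ?thesis by simp
  qed
  moreover have "(\<Union>k. A k) = space \<nu>"
  proof -
    have "\<exists>k. u \<in> A k" if "u \<in> space \<nu>" for u
    proof -
      have "w u > 0" using that by (simp add: space w_def)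
      then obtain k where "inverse (real (Suc k)) < w u"
        using reals_Archimedean by blast
      then show ?thesis
        using that by (intro exI[of _ k]) (simp add: A_def inverse_eq_divide)
    qed
    then show ?thesis by (auto simp: A_def)
  qed
  ultimately show "\<exists>B. countable B \<and> B \<subseteq> sets \<nu> \<and> \<Union> B = space \<nu> \<and> (\<forall>b\<in>B. emeasure \<nu> b \<noteq> \<infinity>)"
    using A_sets by (intro exI[of _ "range A"]) auto
qed

lemma nn_integral_levy_diff_le_sum:
  fixes P \<nu> :: "(real ^ 'n) measure"
  assumes P: "prob_space P" and sets_P [measurable_cong]: "sets P = sets borel"
    and \<nu>: "levy_measure \<nu>"
  shows "(\<integral>\<^sup>+ z. (\<integral>\<^sup>+ u. ennreal (1 - cos ((fst z - snd z) \<bullet> u)) \<partial>\<nu>) \<partial>(P \<Otimes>\<^sub>M P))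
    \<le> (\<integral>\<^sup>+ z. (\<integral>\<^sup>+ u. ennreal (1 - cos ((fst z + snd z) \<bullet> u)) \<partial>\<nu>) \<partial>(P \<Otimes>\<^sub>M P))"
proof -
  interpret prob_space P by fact
  interpret PP: pair_prob_space P P ..
  interpret \<nu>: sigma_finite_measure \<nu> by (rule levy_measure_sigma_finite[OF \<nu>])
  interpret N: pair_sigma_finite "P \<Otimes>\<^sub>M P" \<nu> ..
  note levy_measure_measurable_ident[OF \<nu>, measurable]
  have "(\<integral>\<^sup>+ z. (\<integral>\<^sup>+ u. ennreal (1 - cos ((fst z - snd z) \<bullet> u)) \<partial>\<nu>) \<partial>(P \<Otimes>\<^sub>M P))
    = (\<integral>\<^sup>+ u. (\<integral>\<^sup>+ z. ennreal (1 - cos ((fst z - snd z) \<bullet> u)) \<partial>(P \<Otimes>\<^sub>M P)) \<partial>\<nu>)"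
    by (rule N.Fubini'[symmetric]) measurable
  also have "\<dots> \<le> (\<integral>\<^sup>+ u. (\<integral>\<^sup>+ z. ennreal (1 - cos ((fst z + snd z) \<bullet> u)) \<partial>(P \<Otimes>\<^sub>M P)) \<partial>\<nu>)"
    by (intro nn_integral_mono nn_integral_one_minus_cos_diff_le_sum P sets_P)
  also have "\<dots> = (\<integral>\<^sup>+ z. (\<integral>\<^sup>+ u. ennreal (1 - cos ((fst z + snd z) \<bullet> u)) \<partial>\<nu>) \<partial>(P \<Otimes>\<^sub>M P))"
    by (rule N.Fubini') measurable
  finally show ?thesis .
qed

section \<open>The Gaussian part\<close>

lemma borel_measurable_quadratic_form [measurable]:
  "(\<lambda>x. (Q *v x) \<bullet> x) \<in> borel_measurable (borel :: (real ^ 'n) measure)"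
  by (intro borel_measurable_continuous_onI continuous_intros)

lemma quadratic_form_sum_eq_diff_plus_kernel:
  fixes Q :: "real ^ 'n ^ 'n"
  assumes "transpose Q = Q"
  shows "(Q *v (x + y)) \<bullet> (x + y) = (Q *v (x - y)) \<bullet> (x - y) + 4 * ((Q *v x) \<bullet> y)"
proof -
  have "(Q *v y) \<bullet> x = (Q *v x) \<bullet> y"
    using dot_lmul_matrix[of x Q y] assms
    by (metis inner_commute transpose_matrix_vector)
  then show ?thesis
    by (simp add: matrix_vector_right_distrib matrix_vector_mult_diff_distrib
        inner_add_left inner_add_right inner_diff_left inner_diff_right)
qed

text \<open>With both arguments confined to a ball, the gain is the kernel of \<open>4 * Q\<close> at the identity
  truncated to that ball, which is bounded.\<close>

lemma nn_integral_truncated_quadratic_form_diff_le_sum: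
  fixes P :: "(real ^ 'n) measure" and k :: nat
  assumes P: "prob_space P" and [measurable_cong]: "sets P = sets borel"
    and Q: "positive_semidefinite Q"
  defines "T \<equiv> \<lambda>z. indicator (cball 0 (real k)) (fst z) * indicator (cball 0 (real k)) (snd z) :: real"
  shows "(\<integral>\<^sup>+ z. ennreal (T z * ((Q *v (fst z - snd z)) \<bullet> (fst z - snd z))) \<partial>(P \<Otimes>\<^sub>M P))
    \<le> (\<integral>\<^sup>+ z. ennreal (T z * ((Q *v (fst z + snd z)) \<bullet> (fst z + snd z))) \<partial>(P \<Otimes>\<^sub>M P))"
proof -
  define \<phi> :: "real ^ 'n \<Rightarrow> real ^ 'n" where "\<phi> x = indicator (cball 0 (real k)) x *\<^sub>R x" for x
  have [measurable]: "cball (0 :: real ^ 'n) (real k) \<in> sets borel"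
    by simp
  have [measurable]: "\<phi> \<in> borel_measurable P"
    unfolding \<phi>_def by measurable
  have sym: "transpose Q = Q" and pos: "\<And>x. 0 \<le> (Q *v x) \<bullet> x"
    using Q by (auto simp: positive_semidefinite_def)
  note kernel = integral_positive_kernel_nonneg[OF P \<open>\<phi> \<in> _\<close>, of "real k" "(*v) Q",
      OF _ matrix_vector_mul_bounded_linear pos]
  have \<phi>_bounded: "norm (\<phi> x) \<le> real k" for x
    by (simp add: \<phi>_def indicator_def)
  show ?thesis
  proof (rule nn_integral_le_of_integrable_gain)
    show "T z * ((Q *v (fst z + snd z)) \<bullet> (fst z + snd z))
        = T z * ((Q *v (fst z - snd z)) \<bullet> (fst z - snd z))
          + 4 * ((Q *v \<phi> (fst z)) \<bullet> \<phi> (snd z))" for z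
      using quadratic_form_sum_eq_diff_plus_kernel[OF sym, of "fst z" "snd z"]
      by (simp add: T_def \<phi>_def indicator_def)
    show "integrable (P \<Otimes>\<^sub>M P) (\<lambda>z. 4 * ((Q *v \<phi> (fst z)) \<bullet> \<phi> (snd z)))"
      using kernel(1)[OF \<phi>_bounded] by (rule integrable_mult_right)
    show "0 \<le> (\<integral>z. 4 * ((Q *v \<phi> (fst z)) \<bullet> \<phi> (snd z)) \<partial>(P \<Otimes>\<^sub>M P))"
      using kernel(2)[OF \<phi>_bounded] by simp
    show "(\<lambda>z. T z * ((Q *v (fst z + snd z)) \<bullet> (fst z + snd z))) \<in> borel_measurable (P \<Otimes>\<^sub>M P)"
      unfolding T_def by measurable
  qed (simp_all add: T_def pos)
qed

lemma nn_integral_quadratic_form_diff_le_sum: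
  fixes P :: "(real ^ 'n) measure"
  assumes P: "prob_space P" and sets_P [measurable_cong]: "sets P = sets borel"
    and Q: "positive_semidefinite Q"
  shows "(\<integral>\<^sup>+ z. ennreal ((Q *v (fst z - snd z)) \<bullet> (fst z - snd z)) \<partial>(P \<Otimes>\<^sub>M P))
    \<le> (\<integral>\<^sup>+ z. ennreal ((Q *v (fst z + snd z)) \<bullet> (fst z + snd z)) \<partial>(P \<Otimes>\<^sub>M P))"
proof -
  define T :: "nat \<Rightarrow> (real ^ 'n) \<times> (real ^ 'n) \<Rightarrow> real" where
    "T k z = indicator (cball 0 (real k)) (fst z) * indicator (cball 0 (real k)) (snd z)" for k z
  define g where "g z = (Q *v (fst z - snd z)) \<bullet> (fst z - snd z)" for z
  define h where "h z = (Q *v (fst z + snd z)) \<bullet> (fst z + snd z)" for z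
  have pos: "0 \<le> g z" "0 \<le> h z" for z
    using Q by (auto simp: positive_semidefinite_def g_def h_def)
  have [measurable]: "cball (0 :: real ^ 'n) (real k) \<in> sets borel" for k
    by simp
  have [measurable]: "T k \<in> borel_measurable (P \<Otimes>\<^sub>M P)" for k
    unfolding T_def by measurable
  have [measurable]: "g \<in> borel_measurable (P \<Otimes>\<^sub>M P)"
    unfolding g_def by measurable
  have le: "(\<integral>\<^sup>+ z. ennreal (T k z * g z) \<partial>(P \<Otimes>\<^sub>M P)) \<le> (\<integral>\<^sup>+ z. ennreal (h z) \<partial>(P \<Otimes>\<^sub>M P))" for k
  proof -
    have "(\<integral>\<^sup>+ z. ennreal (T k z * g z) \<partial>(P \<Otimes>\<^sub>M P)) \<le> (\<integral>\<^sup>+ z. ennreal (T k z * h z) \<partial>(P \<Otimes>\<^sub>M P))"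
      using nn_integral_truncated_quadratic_form_diff_le_sum[OF P sets_P Q, of k]
      by (simp add: T_def g_def h_def)
    also have "\<dots> \<le> (\<integral>\<^sup>+ z. ennreal (h z) \<partial>(P \<Otimes>\<^sub>M P))"
      using pos by (intro nn_integral_mono ennreal_leI) (auto simp: T_def indicator_def)
    finally show ?thesis .
  qed
  have "(\<lambda>k. \<integral>\<^sup>+ z. ennreal (T k z * g z) \<partial>(P \<Otimes>\<^sub>M P)) \<longlonglongrightarrow> (\<integral>\<^sup>+ z. ennreal (g z) \<partial>(P \<Otimes>\<^sub>M P))"
  proof (rule nn_integral_LIMSEQ)
    show "incseq (\<lambda>k z. ennreal (T k z * g z))"
      using pos by (auto simp: incseq_def le_fun_def T_def indicator_def intro!: ennreal_leI)
    show "(\<lambda>k. ennreal (T k z * g z)) \<longlonglongrightarrow> ennreal (g z)" for z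
    proof (rule tendsto_eventually)
      have "eventually (\<lambda>k. max (norm (fst z)) (norm (snd z)) \<le> real k) sequentially"
        using filterlim_real_sequentially unfolding filterlim_at_top by blast
      then show "eventually (\<lambda>k. ennreal (T k z * g z) = ennreal (g z)) sequentially"
        by eventually_elim (simp add: T_def)
    qed
  qed measurable
  then have "(\<integral>\<^sup>+ z. ennreal (g z) \<partial>(P \<Otimes>\<^sub>M P)) \<le> (\<integral>\<^sup>+ z. ennreal (h z) \<partial>(P \<Otimes>\<^sub>M P))"
    by (rule LIMSEQ_le_const2) (use le in blast)
  then show ?thesis by (simp add: g_def h_def)
qed

section \<open>Independent, identically distributed vectors\<close>

theorem theorem2p1:
  fixes \<psi> :: "real ^ 'n \<Rightarrow> real"
    and M :: "'w measure"
    and X Y :: "'w \<Rightarrow> real ^ 'n"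
  assumes "continuous_negative_definite \<psi>"
    and "prob_space M"
    and "prob_space.indep_var M borel X borel Y"
    and "distr M borel X = distr M borel Y"
  shows "(\<integral>\<^sup>+ \<omega>. ennreal (\<psi> (X \<omega> - Y \<omega>)) \<partial>M) \<le> (\<integral>\<^sup>+ \<omega>. ennreal (\<psi> (X \<omega> + Y \<omega>)) \<partial>M)"
proof -
  obtain a Q \<nu> where a: "0 \<le> a" and Q: "positive_semidefinite Q" and \<nu>: "levy_measure \<nu>"
    and rep: "\<And>\<xi>. \<psi> \<xi> = a + 1 / 2 * ((Q *v \<xi>) \<bullet> \<xi>) + (\<integral>u. 1 - cos (\<xi> \<bullet> u) \<partial>\<nu>)"
    using assms(1) unfolding continuous_negative_definite_def by blast
  interpret M: prob_space M by fact
  have [measurable]: "X \<in> borel_measurable M" "Y \<in> borel_measurable M"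
    using M.indep_var_rv1[OF assms(3)] M.indep_var_rv2[OF assms(3)] by auto
  define P where "P = distr M borel X"
  have P: "prob_space P"
    unfolding P_def by (rule M.prob_space_distr) measurable
  have sets_P [measurable_cong]: "sets P = sets borel"
    by (simp add: P_def)
  have joint: "distr M (borel \<Otimes>\<^sub>M borel) (\<lambda>\<omega>. (X \<omega>, Y \<omega>)) = P \<Otimes>\<^sub>M P"
    using assms(3,4) by (simp add: M.indep_var_distribution_eq P_def)

  define c where "c \<xi> = ennreal (1 / 2) * ennreal ((Q *v \<xi>) \<bullet> \<xi>)" for \<xi>
  define J where "J \<xi> = (\<integral>\<^sup>+ u. ennreal (1 - cos (\<xi> \<bullet> u)) \<partial>\<nu>)" for \<xi>
  have \<psi>_eq: "ennreal (\<psi> \<xi>) = ennreal a + c \<xi> + J \<xi>" for \<xi>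
  proof -
    have q: "0 \<le> (Q *v \<xi>) \<bullet> \<xi>"
      using Q by (simp add: positive_semidefinite_def)
    have "J \<xi> = ennreal (\<integral>u. 1 - cos (\<xi> \<bullet> u) \<partial>\<nu>)"
      unfolding J_def by (intro nn_integral_eq_integral levy_measure_integrable \<nu>) simp
    moreover have "c \<xi> = ennreal (1 / 2 * ((Q *v \<xi>) \<bullet> \<xi>))"
      unfolding c_def using q by (intro ennreal_mult[symmetric]) auto
    moreover have "0 \<le> (\<integral>u. 1 - cos (\<xi> \<bullet> u) \<partial>\<nu>)"
      by (intro Bochner_Integration.integral_nonneg) simp
    ultimately show ?thesis
      using a q by (simp add: rep ennreal_plus[symmetric] del: ennreal_plus)
  qed
  have [measurable]: "c \<in> borel_measurable borel"
    unfolding c_def by measurable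
  have [measurable]: "J \<in> borel_measurable borel"
  proof -
    interpret \<nu>: sigma_finite_measure \<nu> by (rule levy_measure_sigma_finite[OF \<nu>])
    note levy_measure_measurable_ident[OF \<nu>, measurable]
    show ?thesis unfolding J_def by measurable
  qed
  have split: "(\<integral>\<^sup>+ \<omega>. ennreal (\<psi> (s (X \<omega>) (Y \<omega>))) \<partial>M)
      = (\<integral>\<^sup>+ z. ennreal a \<partial>(P \<Otimes>\<^sub>M P))
        + ennreal (1 / 2) * (\<integral>\<^sup>+ z. ennreal ((Q *v s (fst z) (snd z)) \<bullet> s (fst z) (snd z)) \<partial>(P \<Otimes>\<^sub>M P))
        + (\<integral>\<^sup>+ z. J (s (fst z) (snd z)) \<partial>(P \<Otimes>\<^sub>M P))"
    if s [measurable]: "(\<lambda>z. s (fst z) (snd z)) \<in> borel_measurable (borel \<Otimes>\<^sub>M borel)"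
    for s :: "real ^ 'n \<Rightarrow> real ^ 'n \<Rightarrow> real ^ 'n"
  proof -
    have [measurable]: "(\<lambda>z. s (fst z) (snd z)) \<in> borel_measurable (P \<Otimes>\<^sub>M P)"
      using s by (simp add: measurable_cong_sets[OF sets_pair_measure_cong[OF sets_P sets_P] refl])
    have "(\<integral>\<^sup>+ \<omega>. ennreal (\<psi> (s (X \<omega>) (Y \<omega>))) \<partial>M)
      = (\<integral>\<^sup>+ z. ennreal a + c (s (fst z) (snd z)) + J (s (fst z) (snd z)) \<partial>(P \<Otimes>\<^sub>M P))"
      unfolding joint[symmetric] by (subst nn_integral_distr) (measurable, simp add: \<psi>_eq)
    also have "\<dots> = (\<integral>\<^sup>+ z. ennreal a \<partial>(P \<Otimes>\<^sub>M P)) + (\<integral>\<^sup>+ z. c (s (fst z) (snd z)) \<partial>(P \<Otimes>\<^sub>M P))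
        + (\<integral>\<^sup>+ z. J (s (fst z) (snd z)) \<partial>(P \<Otimes>\<^sub>M P))"
      by (simp add: nn_integral_add)
    also have "(\<integral>\<^sup>+ z. c (s (fst z) (snd z)) \<partial>(P \<Otimes>\<^sub>M P))
      = ennreal (1 / 2) * (\<integral>\<^sup>+ z. ennreal ((Q *v s (fst z) (snd z)) \<bullet> s (fst z) (snd z)) \<partial>(P \<Otimes>\<^sub>M P))"
      unfolding c_def by (rule nn_integral_cmult) measurable
    finally show ?thesis .
  qed
  have "(\<integral>\<^sup>+ z. J (fst z - snd z) \<partial>(P \<Otimes>\<^sub>M P)) \<le> (\<integral>\<^sup>+ z. J (fst z + snd z) \<partial>(P \<Otimes>\<^sub>M P))"
    unfolding J_def by (rule nn_integral_levy_diff_le_sum[OF P sets_P \<nu>])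
  then show ?thesis
    using nn_integral_quadratic_form_diff_le_sum[OF P sets_P Q]
    by (subst (1 2) split) (measurable, auto intro!: add_mono mult_left_mono)
qed

end
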